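(* Let $\mathbf{A}$ be a $\mathbb{Z}_2$-graded commutative, associative algebra over a field of characteristic $0$, let $\pi=[\![\cdot,\cdot]\!]$ be an odd Poisson bracket on $\mathbf{A}$, and let $\operatorname{div}:\operatorname{Der}\mathbf{A}\to\mathbf{A}$ be a divergence operator on $\mathbf{A}$. For $f\in\mathbf{A}$ let $X^{\pi}_f=[\![f,\cdot\,]\!]\in\operatorname{Der}\mathbf{A}$. Then the linear operator $\Delta:\mathbf{A}\to\mathbf{A}$ defined by $$\Delta f=(-1)^{|f|}\tfrac12\operatorname{div}(X^{\pi}_f)$$ is a generator of the bracket $\pi$.
   Context: $|a|$ denotes the $\mathbb{Z}_2$-degree of a homogeneous element $a$; formulas involving $|a|$ are stated for homogeneous elements and extended by linearity. $\operatorname{Der}\mathbf{A}$ is the graded vector space of graded derivations of $\mathbf{A}$: a homogeneous $D$ satisfies $D(fg)=D(f)g+(-1)^{|D||f|}fD(g)$. An odd Poisson bracket on $\mathbf{A}$ is a bilinear map $(f,g)\mapsto[\![f,g]\!]$ from $\mathbf{A}\times\mathbf{A}$ to $\mathbf{A}$, odd in the sense that $|[\![f,g]\!]|=|f|+|g|-1$ mod $2$, such that for all $f,g,h$: (1) $[\![f,g]\!]=-(-1)^{(|f|-1)(|g|-1)}[\![g,f]\!]$; (2) $[\![f,[\![g,h]\!]]\!]=[\![[\![f,g]\!],h]\!]+(-1)^{(|f|-1)(|g|-1)}[\![g,[\![f,h]\!]]\!]$; (3) $[\![f,gh]\!]=[\![f,g]\!]h+(-1)^{(|f|-1)|g|}g[\![f,h]\!]$.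 A generator of the bracket is a linear map $\Delta:\mathbf{A}\to\mathbf{A}$ of odd degree such that for all $f,g\in\mathbf{A}$ $$[\![f,g]\!]=(-1)^{|f|}\bigl(\Delta(fg)-(\Delta f)g-(-1)^{|f|}f(\Delta g)\bigr).$$ A divergence operator on $\mathbf{A}$ is an even linear map $\operatorname{div}:\operatorname{Der}\mathbf{A}\to\mathbf{A}$ such that $\operatorname{div}(fD)=f\operatorname{div}(D)+(-1)^{|f||D|}D(f)$ for all $D\in\operatorname{Der}\mathbf{A}$ and $f\in\mathbf{A}$. *)

theory Defs
  imports Complex_Main "HOL-Library.Z2"
begin

text \<open>Degrees in $\mathbf{Z}_2$ are elements of the two-element field \<^typ>\<open>bit\<close>, so that the
  products and differences of degrees in sign exponents are computed mod 2. No unit is required of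
  the algebra: \<^class>\<open>ring\<close> is the class of associative rings that need be neither unital nor
  commutative. In every sign formula the arguments are homogeneous whenever their degree occurs in it,
  and arbitrary otherwise.\<close>

definition ksign :: "bit \<Rightarrow> 'k::field" where
  "ksign p = (if p = 0 then 1 else - 1)"

locale graded_comm_algebra = vector_space scale
  for scale :: "'k::field \<Rightarrow> 'a::ring \<Rightarrow> 'a" +
  fixes A :: "bit \<Rightarrow> 'a set"
  assumes scale_mult_left: "scale c x * y = scale c (x * y)"
    and scale_mult_right: "x * scale c y = scale c (x * y)"
    and subspace_degree: "subspace (A p)"
    and degree_inter: "A 0 \<inter> A 1 = {0}"
    and degree_sum: "\<exists>x\<^sub>0\<in>A 0. \<exists>x\<^sub>1\<in>A 1. x = x\<^sub>0 + x\<^sub>1"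
    and degree_mult: "f \<in> A p \<Longrightarrow> g \<in> A q \<Longrightarrow> f * g \<in> A (p + q)"
    and graded_comm: "f \<in> A p \<Longrightarrow> g \<in> A q \<Longrightarrow> f * g = scale (ksign (p * q)) (g * f)"

definition homogeneous_derivations ::
    "('k::field \<Rightarrow> 'a::ring \<Rightarrow> 'a) \<Rightarrow> (bit \<Rightarrow> 'a set) \<Rightarrow> bit \<Rightarrow> ('a \<Rightarrow> 'a) set" where
  "homogeneous_derivations scale A p =
    {D. Vector_Spaces.linear scale scale D \<and>
        (\<forall>q. \<forall>f\<in>A q. D f \<in> A (p + q)) \<and>
        (\<forall>q. \<forall>f\<in>A q. \<forall>g. D (f * g) = D f * g + scale (ksign (p * q)) (f * D g))}"

definition Der :: "('k::field \<Rightarrow> 'a::ring \<Rightarrow> 'a) \<Rightarrow> (bit \<Rightarrow> 'a set) \<Rightarrow> ('a \<Rightarrow> 'a) set" where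
  "Der scale A = {\<lambda>x. D\<^sub>0 x + D\<^sub>1 x | D\<^sub>0 D\<^sub>1.
    D\<^sub>0 \<in> homogeneous_derivations scale A 0 \<and> D\<^sub>1 \<in> homogeneous_derivations scale A 1}"

definition odd_poisson_bracket ::
    "('k::field \<Rightarrow> 'a::ring \<Rightarrow> 'a) \<Rightarrow> (bit \<Rightarrow> 'a set) \<Rightarrow> ('a \<Rightarrow> 'a \<Rightarrow> 'a) \<Rightarrow> bool" where
  "odd_poisson_bracket scale A br \<longleftrightarrow>
    (\<forall>f. Vector_Spaces.linear scale scale (\<lambda>g. br f g)) \<and>
    (\<forall>g. Vector_Spaces.linear scale scale (\<lambda>f. br f g)) \<and>
    (\<forall>p q. \<forall>f\<in>A p. \<forall>g\<in>A q. br f g \<in> A (p + q - 1)) \<and>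
    (\<forall>p q. \<forall>f\<in>A p. \<forall>g\<in>A q.
      br f g = - scale (ksign ((p - 1) * (q - 1))) (br g f)) \<and>
    (\<forall>p q. \<forall>f\<in>A p. \<forall>g\<in>A q. \<forall>h.
      br f (br g h) = br (br f g) h + scale (ksign ((p - 1) * (q - 1))) (br g (br f h))) \<and>
    (\<forall>p q. \<forall>f\<in>A p. \<forall>g\<in>A q. \<forall>h.
      br f (g * h) = br f g * h + scale (ksign ((p - 1) * q)) (g * br f h))"

text \<open>A divergence operator is a function on all maps of the algebra of which only the values on
  \<^const>\<open>Der\<close> are constrained or used.\<close>

definition divergence_operator ::
    "('k::field \<Rightarrow> 'a::ring \<Rightarrow> 'a) \<Rightarrow> (bit \<Rightarrow> 'a set) \<Rightarrow> (('a \<Rightarrow> 'a) \<Rightarrow> 'a) \<Rightarrow> bool" where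
  "divergence_operator scale A dv \<longleftrightarrow>
    (\<forall>D\<in>Der scale A. \<forall>E\<in>Der scale A. dv (\<lambda>x. D x + E x) = dv D + dv E) \<and>
    (\<forall>c. \<forall>D\<in>Der scale A. dv (\<lambda>x. scale c (D x)) = scale c (dv D)) \<and>
    (\<forall>p. \<forall>D\<in>homogeneous_derivations scale A p. dv D \<in> A p) \<and>
    (\<forall>p q. \<forall>D\<in>homogeneous_derivations scale A p. \<forall>f\<in>A q.
      dv (\<lambda>x. f * D x) = f * dv D + scale (ksign (q * p)) (D f))"

definition is_generator ::
    "('k::field \<Rightarrow> 'a::ring \<Rightarrow> 'a) \<Rightarrow> (bit \<Rightarrow> 'a set) \<Rightarrow> ('a \<Rightarrow> 'a \<Rightarrow> 'a) \<Rightarrow> ('a \<Rightarrow> 'a) \<Rightarrow> bool" where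
  "is_generator scale A br \<Delta> \<longleftrightarrow>
    Vector_Spaces.linear scale scale \<Delta> \<and>
    (\<forall>p. \<forall>f\<in>A p. \<Delta> f \<in> A (p + 1)) \<and>
    (\<forall>p. \<forall>f\<in>A p. \<forall>g.
      br f g = scale (ksign p) (\<Delta> (f * g) - \<Delta> f * g - scale (ksign p) (f * \<Delta> g)))"

definition hamiltonian_field :: "('a \<Rightarrow> 'a \<Rightarrow> 'a) \<Rightarrow> 'a \<Rightarrow> 'a \<Rightarrow> 'a" where
  "hamiltonian_field br f = (\<lambda>g. br f g)"

definition component :: "(bit \<Rightarrow> 'a::ring set) \<Rightarrow> bit \<Rightarrow> 'a \<Rightarrow> 'a" where
  "component A p f = (THE g. g \<in> A p \<and> f - g \<in> A (p + 1))"

text \<open>The extension by linearity of a formula \<open>F p f\<close> that is given for \<open>f\<close> homogeneous of degree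
  \<open>p\<close>.\<close>

definition extend_linearly :: "(bit \<Rightarrow> 'a::ring set) \<Rightarrow> (bit \<Rightarrow> 'a \<Rightarrow> 'a) \<Rightarrow> 'a \<Rightarrow> 'a" where
  "extend_linearly A F f = F 0 (component A 0 f) + F 1 (component A 1 f)"

definition divergence_laplacian ::
    "('k::field \<Rightarrow> 'a::ring \<Rightarrow> 'a) \<Rightarrow> (bit \<Rightarrow> 'a set) \<Rightarrow> ('a \<Rightarrow> 'a \<Rightarrow> 'a) \<Rightarrow> (('a \<Rightarrow> 'a) \<Rightarrow> 'a) \<Rightarrow> 'a \<Rightarrow> 'a" where
  "divergence_laplacian scale A br dv =
    extend_linearly A (\<lambda>p f. scale (ksign p) (scale (1 / 2) (dv (hamiltonian_field br f))))"

context graded_comm_algebra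
begin

lemma component_unique:
  assumes "x \<in> A p" "y \<in> A (p + 1)"
  shows "component A p (x + y) = x"
  unfolding component_def
proof (rule the_equality)
  show "x \<in> A p \<and> x + y - x \<in> A (p + 1)" using assms by simp
next
  fix g assume g: "g \<in> A p \<and> x + y - g \<in> A (p + 1)"
  have "x - g \<in> A p" using g assms(1) subspace_degree subspace_diff by blast
  moreover have "x - g \<in> A (p + 1)"
    using g assms(2) subspace_diff[OF subspace_degree, of "x + y - g" "p + 1" y]
    by (simp add: algebra_simps)
  ultimately have "x - g \<in> A 0 \<inter> A 1" by (cases p rule: bit.exhaust) auto
  then show "g = x" using degree_inter by simp
qed

lemma extend_linearly_homogeneous:
  assumes "f \<in> A p" "F (p + 1) 0 = 0"
  shows "extend_linearly A F f = F p f"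
proof -
  have z: "0 \<in> A q" for q using subspace_degree subspace_0 by blast
  have "component A p f = f" using component_unique[OF assms(1) z] by simp
  moreover have "component A (p + 1) f = 0"
    using component_unique[OF z, of f "p + 1"] assms(1)
    by (cases p rule: bit.exhaust) auto
  ultimately show ?thesis
    using assms(2) by (cases p rule: bit.exhaust) (auto simp: extend_linearly_def)
qed

lemma hamiltonian_field_homogeneous:
  assumes br: "odd_poisson_bracket scale A br" and f: "f \<in> A p"
  shows "hamiltonian_field br f \<in> homogeneous_derivations scale A (p - 1)"
proof -
  have lin: "Vector_Spaces.linear scale scale (br f)"
    using br by (simp add: odd_poisson_bracket_def)
  have deg: "br f g \<in> A (p - 1 + q)" if "g \<in> A q" for g q
  proof -
    have "br f g \<in> A (p + q - 1)" using br f that unfolding odd_poisson_bracket_def by blast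
    then show ?thesis by (simp only: diff_add_eq)
  qed
  have leib: "br f (g * h) = br f g * h + scale (ksign ((p - 1) * q)) (g * br f h)"
    if "g \<in> A q" for g h q
    using br f that unfolding odd_poisson_bracket_def by blast
  show ?thesis
    unfolding homogeneous_derivations_def hamiltonian_field_def mem_Collect_eq
    by (intro conjI allI ballI lin deg leib)
qed

lemma zero_derivation: "(\<lambda>x. 0) \<in> homogeneous_derivations scale A p"
  unfolding homogeneous_derivations_def
  using subspace_0[OF subspace_degree] by (auto simp: Vector_Spaces.linear_iff vector_space_axioms)

lemma homogeneous_in_Der:
  assumes "D \<in> homogeneous_derivations scale A p"
  shows "D \<in> Der scale A"
proof (cases "p = 0")
  case True
  then show ?thesis unfolding Der_def mem_Collect_eq
    using assms zero_derivation[of 1] by (intro exI[of _ D] exI[of _ "\<lambda>x. 0"]) simp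
next
  case False
  then show ?thesis unfolding Der_def mem_Collect_eq
    using assms zero_derivation[of 0] by (intro exI[of _ "\<lambda>x. 0"] exI[of _ D]) simp
qed

lemma hamiltonian_field_in_Der:
  assumes br: "odd_poisson_bracket scale A br"
  shows "hamiltonian_field br f \<in> Der scale A"
proof -
  obtain f0 f1 where f: "f0 \<in> A 0" "f1 \<in> A 1" "f = f0 + f1" using degree_sum by blast
  have "Vector_Spaces.linear scale scale (\<lambda>f. br f g)" for g
    using br by (simp add: odd_poisson_bracket_def)
  then have "br (f0 + f1) g = br f1 g + br f0 g" for g
    by (simp add: Vector_Spaces.linear_iff add.commute)
  then have "hamiltonian_field br f = (\<lambda>g. hamiltonian_field br f1 g + hamiltonian_field br f0 g)"
    by (simp add: hamiltonian_field_def f(3))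
  moreover have "hamiltonian_field br f1 \<in> homogeneous_derivations scale A 0"
    "hamiltonian_field br f0 \<in> homogeneous_derivations scale A 1"
    using hamiltonian_field_homogeneous[OF br f(2)] hamiltonian_field_homogeneous[OF br f(1)] by auto
  ultimately show ?thesis unfolding Der_def by blast
qed

lemma divergence_laplacian_homogeneous:
  assumes br: "odd_poisson_bracket scale A br" and dv: "divergence_operator scale A dv"
    and f: "f \<in> A p"
  shows "divergence_laplacian scale A br dv f =
    scale (ksign p) (scale (1 / 2) (dv (hamiltonian_field br f)))"
proof -
  have "Vector_Spaces.linear scale scale (\<lambda>f. br f g)" for g
    using br by (simp add: odd_poisson_bracket_def)
  then have "br (scale 0 0) g = scale 0 (br 0 g)" for g
    unfolding Vector_Spaces.linear_iff by blast
  then have "hamiltonian_field br 0 = (\<lambda>g. scale 0 (hamiltonian_field br 0 g))"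
    by (simp add: hamiltonian_field_def)
  moreover have "dv (\<lambda>g. scale 0 (hamiltonian_field br 0 g)) = scale 0 (dv (hamiltonian_field br 0))"
    using dv hamiltonian_field_in_Der[OF br] unfolding divergence_operator_def by blast
  ultimately have "dv (hamiltonian_field br 0) = 0" by simp
  then show ?thesis unfolding divergence_laplacian_def
    by (intro extend_linearly_homogeneous[OF f]) simp
qed

end

end

theory Submission
  imports Defs
begin

text \<open>The Leibniz rule in the first argument reads
  $X_{fg} = f X_g + (-1)^{|f||g|} g X_f$. Applying the divergence to it produces, besides
  $f \operatorname{div} X_g$ and $(-1)^{|f||g|} g \operatorname{div} X_f$, the two terms
  $X_g(f)$ and $X_f(g)$ up to sign; by the antisymmetry of the bracket these coincide, with total
  $2 (-1)^{|g|} [\![f,g]\!]$, and the factor $\frac12$ leaves the bracket.\<close>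

lemma ksign_simps: "ksign 0 = 1" "ksign 1 = - 1"
  by (simp_all add: ksign_def)

lemma ksign_mult: "ksign p * ksign q = ksign (p + q)"
  by (cases p rule: bit.exhaust; cases q rule: bit.exhaust) (simp_all add: ksign_simps)

context graded_comm_algebra
begin

lemma degree_closed:
  "0 \<in> A p"
  "x \<in> A p \<Longrightarrow> y \<in> A p \<Longrightarrow> x + y \<in> A p"
  "x \<in> A p \<Longrightarrow> scale c x \<in> A p"
  using subspace_degree[of p] by (simp_all add: subspace_0 subspace_add subspace_scale)

lemma scale_minus_one: "scale (- 1) x = - x"
  using scale_minus_left[of 1 x] by simp

text \<open>Reduces an identity additive in one argument to homogeneous values of that argument,
  where every sign is determined.\<close>

lemma homogeneous_induct [consumes 0, case_names homogeneous add]: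
  assumes "\<And>p x. x \<in> A p \<Longrightarrow> P x" "\<And>x y. P x \<Longrightarrow> P y \<Longrightarrow> P (x + y)"
  shows "P x"
  using degree_sum[of x] assms by metis

lemma components:
  "component A p x \<in> A p" "x = component A 0 x + component A 1 x"
proof -
  obtain x0 x1 where x: "x0 \<in> A 0" "x1 \<in> A 1" "x = x0 + x1"
    using degree_sum by blast
  have c0: "component A 0 x = x0"
    using component_unique[of x0 0 x1] x by simp
  have c1: "component A 1 x = x1"
    using component_unique[of x1 1 x0] x by (simp add: add.commute)
  show "component A p x \<in> A p" "x = component A 0 x + component A 1 x"
    using x c0 c1 by (cases p rule: bit.exhaust; simp)+
qed

lemma component_eq:
  assumes "u \<in> A 0" "v \<in> A 1"
  shows "component A 0 (u + v) = u" "component A 1 (u + v) = v"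
  using component_unique[of u 0 v] component_unique[of v 1 u] assms by (simp_all add: add.commute)

text \<open>Adding the decompositions of \<open>x\<close> and \<open>y\<close> degree by degree
  decomposes \<open>x + y\<close>, and decompositions are unique.\<close>

lemma component_add: "component A p (x + y) = component A p x + component A p y"
proof -
  have e: "x + y = (component A 0 x + component A 0 y) + (component A 1 x + component A 1 y)"
    using components(2)[of x] components(2)[of y] by (metis (no_types) add.assoc add.left_commute)
  show ?thesis
    unfolding e using component_eq[OF degree_closed(2)[OF components(1) components(1)]
        degree_closed(2)[OF components(1) components(1)], of x y x y] e
    by (cases p rule: bit.exhaust) simp_all
qed

lemma component_scale: "component A p (scale c x) = scale c (component A p x)"
proof -
  have e: "scale c x = scale c (component A 0 x) + scale c (component A 1 x)"
    using components(2)[of x] by (metis scale_right_distrib)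
  show ?thesis
    using component_eq[OF degree_closed(3)[OF components(1)] degree_closed(3)[OF components(1)],
        of c x c x] e
    by (cases p rule: bit.exhaust) simp_all
qed

lemma extend_linearly_linear:
  assumes "\<And>p. Vector_Spaces.linear scale scale (F p)"
  shows "Vector_Spaces.linear scale scale (extend_linearly A F)"
proof -
  have add: "F p (x + y) = F p x + F p y" and sc: "F p (scale c x) = scale c (F p x)" for p x y c
    using assms by (simp_all add: Vector_Spaces.linear_iff)
  show ?thesis
    unfolding Vector_Spaces.linear_iff extend_linearly_def
    by (simp add: vector_space_axioms component_add component_scale add sc scale_right_distrib
        algebra_simps)
qed

text \<open>Additivity of a divergence is available only on \<open>Der\<close>, so both summands of
  the Hamiltonian field of a product must be known to be derivations.\<close>

lemma mult_homogeneous_derivation: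
  assumes f: "f \<in> A p" and D: "D \<in> homogeneous_derivations scale A q"
  shows "(\<lambda>x. f * D x) \<in> homogeneous_derivations scale A (p + q)"
proof -
  have lin: "D (x + y) = D x + D y" "D (scale c x) = scale c (D x)" for x y c
    using D by (simp_all add: homogeneous_derivations_def Vector_Spaces.linear_iff)
  have deg: "D x \<in> A (q + r)" if "x \<in> A r" for x r
    using D that by (simp add: homogeneous_derivations_def)
  have leib: "D (x * y) = D x * y + scale (ksign (q * r)) (x * D y)" if "x \<in> A r" for x y r
    using D that by (simp add: homogeneous_derivations_def)
  \<comment> \<open>Moving \<open>f\<close> past \<open>x\<close> costs
    \<open>ksign (p * r)\<close>; with the sign \<open>ksign (q * r)\<close> from the Leibniz rule
    for \<open>D\<close> this is the sign for degree \<open>p + q\<close>.\<close>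
  have swap: "f * (x * z) = scale (ksign (p * r)) (x * (f * z))" if "x \<in> A r" for x z r
    using graded_comm[OF f that] by (simp add: mult.assoc[symmetric] scale_mult_left)
  have "f * D (x * y) = f * D x * y + scale (ksign ((p + q) * r)) (x * (f * D y))"
    if "x \<in> A r" for x y r
  proof -
    have "ksign ((p + q) * r) = (ksign (q * r) * ksign (p * r) :: 'k)"
      by (simp only: ksign_mult distrib_right add.commute)
    then show ?thesis
      by (simp add: leib[OF that] swap[OF that] distrib_left scale_mult_right mult.assoc)
  qed
  moreover have "f * D x \<in> A (p + q + r)" if "x \<in> A r" for x r
    using degree_mult[OF f deg[OF that]] by (simp only: add.assoc)
  ultimately show ?thesis
    unfolding homogeneous_derivations_def Vector_Spaces.linear_iff
    by (simp add: vector_space_axioms lin distrib_left scale_mult_right)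
qed

text \<open>Antisymmetry carries \<open>f * g\<close> into the second argument, where the Leibniz
  rule is an axiom, and then carries each resulting bracket back.\<close>

lemma odd_poisson_leibniz_left:
  assumes br: "odd_poisson_bracket scale A br" and f: "f \<in> A p" and g: "g \<in> A q"
  shows "br (f * g) h = f * br g h + scale (ksign (p * q)) (g * br f h)"
proof (induction h rule: homogeneous_induct)
  case (homogeneous r h)
  have deg: "br x y \<in> A (s + t - 1)" if "x \<in> A s" "y \<in> A t" for x y s t
    using br that unfolding odd_poisson_bracket_def by blast
  have anti: "br x y = - scale (ksign ((s - 1) * (t - 1))) (br y x)"
    if "x \<in> A s" "y \<in> A t" for x y s t
    using br that unfolding odd_poisson_bracket_def by blast
  have leib: "br h (f * g) = br h f * g + scale (ksign ((r - 1) * p)) (f * br h g)"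
    using br homogeneous f unfolding odd_poisson_bracket_def by blast
  have comm: "br h f * g = scale (ksign ((r + p - 1) * q)) (g * br h f)"
    by (rule graded_comm[OF deg[OF homogeneous f] g])
  show ?case
    unfolding anti[OF degree_mult[OF f g] homogeneous] leib comm
      anti[OF f homogeneous] anti[OF g homogeneous]
    \<comment> \<open>All signs depend only on the three degrees mod 2, so eight cases settle the
      comparison.\<close>
    by (cases p rule: bit.exhaust; cases q rule: bit.exhaust; cases r rule: bit.exhaust)
      (simp_all add: ksign_simps scale_minus_one add.commute)
next
  case (add h k)
  have "br x (h + k) = br x h + br x k" for x
    using br by (simp add: odd_poisson_bracket_def Vector_Spaces.linear_iff)
  then show ?case
    by (simp add: add distrib_left scale_right_distrib algebra_simps)
qed

lemma divergence_hamiltonian_mult: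
  assumes br: "odd_poisson_bracket scale A br" and dv: "divergence_operator scale A dv"
    and f: "f \<in> A p" and g: "g \<in> A q"
  defines "X \<equiv> hamiltonian_field br"
  shows "dv (X (f * g)) = f * dv (X g) + scale (ksign (p * q)) (g * dv (X f))
    + scale (2 * ksign q) (br f g)"
proof -
  \<comment> \<open>The sign is absorbed into the homogeneous factor, so that the second summand
    also has the form of an element times a derivation.\<close>
  let ?g = "scale (ksign (p * q)) g"
  have g': "?g \<in> A q" by (rule degree_closed(3)[OF g])
  have Xf: "X f \<in> homogeneous_derivations scale A (p - 1)"
    and Xg: "X g \<in> homogeneous_derivations scale A (q - 1)"
    unfolding X_def by (rule hamiltonian_field_homogeneous[OF br] f g)+
  have "X (f * g) = (\<lambda>x. f * X g x + ?g * X f x)"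
    by (simp add: X_def hamiltonian_field_def odd_poisson_leibniz_left[OF br f g] scale_mult_left)
  then have "dv (X (f * g)) = dv (\<lambda>x. f * X g x) + dv (\<lambda>x. ?g * X f x)"
    using dv homogeneous_in_Der[OF mult_homogeneous_derivation[OF f Xg]]
      homogeneous_in_Der[OF mult_homogeneous_derivation[OF g' Xf]]
    unfolding divergence_operator_def by simp
  also have "dv (\<lambda>x. f * X g x) = f * dv (X g) + scale (ksign (p * (q - 1))) (br g f)"
    using dv f Xg unfolding divergence_operator_def by (simp add: X_def hamiltonian_field_def)
  also have "dv (\<lambda>x. ?g * X f x) = ?g * dv (X f) + scale (ksign (q * (p - 1))) (br f ?g)"
    using dv g' Xf unfolding divergence_operator_def by (simp add: X_def hamiltonian_field_def)
  also have "br f ?g = scale (ksign (p * q)) (br f g)"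
    using br by (simp add: odd_poisson_bracket_def Vector_Spaces.linear_iff)
  also have "br g f = - scale (ksign ((q - 1) * (p - 1))) (br f g)"
    using br f g unfolding odd_poisson_bracket_def by blast
  finally show ?thesis
    \<comment> \<open>Both correction terms equal \<open>scale (ksign q) (br f g)\<close>; this
      instance merges them into the factor 2.\<close>
    using scale_left_distrib[of 1 1 "br f g"]
    by (cases p rule: bit.exhaust; cases q rule: bit.exhaust)
      (simp_all add: ksign_simps scale_minus_one scale_mult_left)
qed

text \<open>The formula being extended is linear in arbitrary \<open>f\<close>, because Hamiltonian
  fields of inhomogeneous elements also lie in \<open>Der\<close>, where the divergence is
  linear.\<close>

lemma divergence_laplacian_linear:
  assumes br: "odd_poisson_bracket scale A br" and dv: "divergence_operator scale A dv"
  shows "Vector_Spaces.linear scale scale (divergence_laplacian scale A br dv)"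
  unfolding divergence_laplacian_def
proof (rule extend_linearly_linear)
  fix p
  let ?X = "hamiltonian_field br"
  have lin: "Vector_Spaces.linear scale scale (\<lambda>f. br f g)" for g
    using br by (simp add: odd_poisson_bracket_def)
  have "?X (f + g) = (\<lambda>x. ?X f x + ?X g x)" "?X (scale c f) = (\<lambda>x. scale c (?X f x))" for f g c
    using lin by (simp_all add: hamiltonian_field_def Vector_Spaces.linear_iff)
  then have "dv (?X (f + g)) = dv (?X f) + dv (?X g)" "dv (?X (scale c f)) = scale c (dv (?X f))"
    for f g c
    using dv hamiltonian_field_in_Der[OF br] unfolding divergence_operator_def by simp_all
  then show "Vector_Spaces.linear scale scale
      (\<lambda>f. scale (ksign p) (scale (1 / 2) (dv (?X f))))"
    by (simp add: Vector_Spaces.linear_iff vector_space_axioms scale_right_distrib mult.commute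
        mult.left_commute)
qed

end

theorem theorem1p2:
  fixes scale :: "'k::field_char_0 \<Rightarrow> 'a::ring \<Rightarrow> 'a"
    and A :: "bit \<Rightarrow> 'a set"
    and br :: "'a \<Rightarrow> 'a \<Rightarrow> 'a"
    and dv :: "('a \<Rightarrow> 'a) \<Rightarrow> 'a"
  assumes "graded_comm_algebra scale A"
    and "odd_poisson_bracket scale A br"
    and "divergence_operator scale A dv"
  shows "is_generator scale A br (divergence_laplacian scale A br dv)"
proof -
  interpret graded_comm_algebra scale A by fact
  note br = assms(2) and dv = assms(3)
  let ?X = "hamiltonian_field br"
  let ?L = "divergence_laplacian scale A br dv"
  note lin = divergence_laplacian_linear[OF br dv]
  note hom = divergence_laplacian_homogeneous[OF br dv]
  have dvX: "dv (?X f) \<in> A (p - 1)" if "f \<in> A p" for f p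
    using dv hamiltonian_field_homogeneous[OF br that] unfolding divergence_operator_def by blast
  \<comment> \<open>In \<open>bit\<close> the degrees \<open>p - 1\<close> and \<open>p + 1\<close>
    coincide.\<close>
  have "?L f \<in> A (p + 1)" if "f \<in> A p" for f p
    using degree_closed(3) dvX[OF that] by (simp add: hom[OF that])
  moreover have "br f g = scale (ksign p) (?L (f * g) - ?L f * g - scale (ksign p) (f * ?L g))"
    if f: "f \<in> A p" for f g p
  proof (induction g rule: homogeneous_induct)
    case (homogeneous q g)
    \<comment> \<open>Puts \<open>?L f * g\<close> into the order in which it cancels against the
      term \<open>g * dv (?X f)\<close> of \<open>?L (f * g)\<close>.\<close>
    have "dv (?X f) * g = scale (ksign ((p - 1) * q)) (g * dv (?X f))"
      by (rule graded_comm[OF dvX[OF f] homogeneous])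
    then show ?case
      unfolding hom[OF f] hom[OF homogeneous] hom[OF degree_mult[OF f homogeneous]]
        divergence_hamiltonian_mult[OF br dv f homogeneous]
      \<comment> \<open>After cancellation the bracket carries the signs of \<open>p\<close>,
        \<open>p + q\<close> and \<open>q\<close>, whose product is 1, and the factors 1/2 and 2,
        which cancel in characteristic 0.\<close>
      by (cases p rule: bit.exhaust; cases q rule: bit.exhaust)
        (simp_all add: ksign_simps scale_minus_one scale_mult_left scale_mult_right
          scale_right_distrib scale_right_diff_distrib)
  next
    case (add g h)
    have "br f (g + h) = br f g + br f h"
      using br by (simp add: odd_poisson_bracket_def Vector_Spaces.linear_iff)
    moreover have "?L (x + y) = ?L x + ?L y" for x y
      using lin by (simp add: Vector_Spaces.linear_iff)
    ultimately show ?case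
      by (simp add: add distrib_left scale_right_distrib scale_right_diff_distrib algebra_simps)
  qed
  ultimately show ?thesis
    unfolding is_generator_def using lin by blast
qed

end
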